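(* Let $s\ge 3$, $k\ge 2$ and $n\ge sk+(s-1)(k-1)$ be integers. Consider an $M$-coloring of $\binom{[n]}{k}$ without a rainbow $s$-matching. Then either this coloring is $s$-star-like, or $M\le h(n,k,s-1)+s$.
   Context: An $M$-coloring of $\binom{[n]}{k}$ is a partition $\binom{[n]}{k}=\mathcal F_1\sqcup\cdots\sqcup\mathcal F_M$ into $M$ non-empty families (color classes). A rainbow $s$-matching is a collection of $s$ pairwise disjoint $k$-sets lying in pairwise distinct color classes. The coloring is $s$-star-like if there exist a set $Y\in\binom{[n]}{s-2}$ and an index $i\in[M]$ such that for every $j\in[M]\setminus\{i\}$ every $F\in\mathcal F_j$ intersects $Y$. For a family $\mathcal F$, $\nu(\mathcal F)$ is the maximum number of pairwise disjoint members and $\tau(\mathcal F)$ is the minimum size of a set meeting every member. Define $h(n,k,t)=\max\{|\mathcal F|:\mathcal F\subset\binom{[n]}{k},\ \nu(\mathcal F)<t,\ \tau(\mathcal F)\ge t\}$. *)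

theory Defs
  imports "HOL-Library.Ramsey" "HOL-Library.Disjoint_Sets"
begin

text \<open>
  The ground set is \<open>{1..n}\<close> and \<open>nsets {1..n} k\<close> is the family of its \<open>k\<close>-element subsets.
  A colouring with \<open>M\<close> colours is given by its colour classes \<open>C 1, \<dots>, C M\<close>; values of \<open>C\<close>
  outside \<open>{1..M}\<close> are irrelevant.
\<close>

definition is_coloring :: "nat \<Rightarrow> nat \<Rightarrow> nat \<Rightarrow> (nat \<Rightarrow> nat set set) \<Rightarrow> bool" where
  "is_coloring n k M C \<longleftrightarrow>
     (\<forall>j\<in>{1..M}. C j \<noteq> {}) \<and>
     disjoint_family_on C {1..M} \<and>
     (\<Union>j\<in>{1..M}. C j) = nsets {1..n} k"

definition rainbow_matching :: "nat \<Rightarrow> nat \<Rightarrow> (nat \<Rightarrow> nat set set) \<Rightarrow> nat set set \<Rightarrow> bool" where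
  "rainbow_matching s M C \<A> \<longleftrightarrow>
     finite \<A> \<and> card \<A> = s \<and> disjoint \<A> \<and>
     (\<exists>c. inj_on c \<A> \<and> (\<forall>A\<in>\<A>. c A \<in> {1..M} \<and> A \<in> C (c A)))"

definition star_like :: "nat \<Rightarrow> nat \<Rightarrow> nat \<Rightarrow> (nat \<Rightarrow> nat set set) \<Rightarrow> bool" where
  "star_like n s M C \<longleftrightarrow>
     (\<exists>Y\<in>nsets {1..n} (s - 2). \<exists>i\<in>{1..M}. \<forall>j\<in>{1..M} - {i}. \<forall>F\<in>C j. F \<inter> Y \<noteq> {})"

definition matching_number :: "'a set set \<Rightarrow> nat" where
  "matching_number \<F> = Max {card \<G> |\<G>. \<G> \<subseteq> \<F> \<and> disjoint \<G>}"

text \<open>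
  Junk values: \<open>matching_number\<close> is meaningful only for finite families, and \<open>covering_number\<close>
  only for families having a finite cover. Both conditions hold for every family of \<open>k\<close>-subsets of
  \<open>{1..n}\<close> with \<open>k \<ge> 1\<close>. Covers may use points outside the ground set, which does not affect
  the minimum.
\<close>

definition covering_number :: "'a set set \<Rightarrow> nat" where
  "covering_number \<F> = (LEAST m. \<exists>Y. finite Y \<and> card Y = m \<and> (\<forall>F\<in>\<F>. F \<inter> Y \<noteq> {}))"

text \<open>
  The maximum is over a nonempty set of families whenever \<open>k, t \<ge> 2\<close> and \<open>n \<ge> t * k - 1\<close>:
  the \<open>k\<close>-subsets of \<open>{1..t * k - 1}\<close> form such a family.
\<close>

definition h :: "nat \<Rightarrow> nat \<Rightarrow> nat \<Rightarrow> nat" where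
  "h n k t = Max {card \<F> |\<F>. \<F> \<subseteq> nsets {1..n} k \<and>
                              matching_number \<F> < t \<and> covering_number \<F> \<ge> t}"

end

theory Submission
  imports Defs
begin

text \<open>
  Suppose \<open>M > h n k (s - 1) + s\<close>. Two distinct \<open>(s - 2)\<close>-sets have at most \<open>h n k (s - 1)\<close> common
  \<open>k\<close>-sets meeting both, so a family with more members and with no \<open>s - 1\<close> disjoint members has
  exactly one cover of size \<open>s - 2\<close>. Removing the colours of a rainbow \<open>(s - 1)\<close>-matching leaves a
  set \<open>K\<close> of at least \<open>h n k (s - 1) + 2\<close> colours without another rainbow \<open>(s - 1)\<close>-matching.
  Every system of representatives of \<open>K\<close> then has a unique cover, which does not change when
  a single representative does, so one set \<open>Y\<close> covers all classes in \<open>K\<close>.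

  If a colour \<open>i\<close> outside \<open>K\<close> has a member avoiding \<open>Y\<close>, then by uniqueness of \<open>Y\<close> the colours
  \<open>K \<union> {i}\<close> admit a rainbow \<open>(s - 1)\<close>-matching. Its \<open>s - 2\<close> sets with colours in \<open>K\<close> use up \<open>Y\<close>, and
  all \<open>k\<close>-sets disjoint from them are forced to have colour \<open>i\<close>. Two such colours would
  both be forced on some \<open>k\<close>-set.
\<close>

section \<open>\<open>k\<close>-sets avoiding or containing prescribed points\<close>

lemma finite_nsets_atLeastAtMost [simp]: "finite (nsets {a..b::nat} k)"
  by (simp add: finite_imp_finite_nsets)

lemma nsets_avoiding_exists:
  fixes W :: "nat set"
  assumes "finite W" "card W + k \<le> n"
  obtains F where "F \<in> nsets {1..n} k" "F \<inter> W = {}"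
proof -
  have "k \<le> card ({1..n} - W)"
    using assms diff_card_le_card_Diff[of W "{1..n}"] by simp
  then obtain F where "F \<subseteq> {1..n} - W" "card F = k" "finite F"
    by (metis obtain_subset_with_card_n)
  then show thesis
    using that by (auto simp: nsets_def)
qed

lemma nsets_extending_exists:
  fixes S W :: "nat set"
  assumes "S \<subseteq> {1..n}" "S \<inter> W = {}" "card S \<le> k" "finite W" "card W + k \<le> n"
  obtains F where "F \<in> nsets {1..n} k" "S \<subseteq> F" "F \<inter> W = {}"
proof -
  have "k \<le> card ({1..n} - W)"
    using assms diff_card_le_card_Diff[of W "{1..n}"] by simp
  then obtain F where "S \<subseteq> F" "F \<subseteq> {1..n} - W" "card F = k"
    using exists_subset_between[of S k "{1..n} - W"] assms by auto
  then show thesis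
    using that[of F] finite_subset[of F "{1..n}"] by (auto simp: nsets_def)
qed

section \<open>Covers of disjoint families\<close>

lemma disjoint_transversal:
  assumes "disjoint \<G>" "finite Y" "\<And>F. F \<in> \<G> \<Longrightarrow> F \<inter> Y \<noteq> {}"
  obtains f where "inj_on f \<G>" "f ` \<G> \<subseteq> Y" "\<And>F. F \<in> \<G> \<Longrightarrow> f F \<in> F"
proof -
  have "\<forall>F\<in>\<G>. \<exists>x. x \<in> F \<inter> Y"
    using assms(3) by blast
  then obtain f where f: "\<And>F. F \<in> \<G> \<Longrightarrow> f F \<in> F \<inter> Y"
    by metis
  have "inj_on f \<G>"
    using f assms(1) by (intro inj_onI) (metis IntE disjoint_iff disjointD)
  then show thesis
    using that f by blast
qed

lemma card_disjoint_le_cover: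
  assumes "disjoint \<G>" "finite Y" "\<And>F. F \<in> \<G> \<Longrightarrow> F \<inter> Y \<noteq> {}"
  shows "card \<G> \<le> card Y"
  using disjoint_transversal[OF assms] assms(2) by (metis card_inj_on_le)

text \<open>One point of \<open>Y\<close> chosen from each member gives \<open>card Y\<close>
  distinct points, hence all of \<open>Y\<close>. This later places a common cover inside the union
  of a matching.\<close>

lemma tight_cover_subset_Union:
  assumes "disjoint \<G>" "finite Y" "\<And>F. F \<in> \<G> \<Longrightarrow> F \<inter> Y \<noteq> {}" "card \<G> = card Y"
  shows "Y \<subseteq> \<Union>\<G>"
proof -
  obtain f where f: "inj_on f \<G>" "f ` \<G> \<subseteq> Y" "\<And>F. F \<in> \<G> \<Longrightarrow> f F \<in> F"
    using disjoint_transversal[OF assms(1-3)] by metis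
  have "f ` \<G> = Y"
    using f assms by (intro card_subset_eq) (auto simp: card_image)
  then show ?thesis
    using f(3) by blast
qed

section \<open>Matching and covering numbers\<close>

lemma matching_number_less_iff:
  assumes "finite \<F>"
  shows "matching_number \<F> < t \<longleftrightarrow> (\<forall>\<G>\<subseteq>\<F>. disjoint \<G> \<longrightarrow> card \<G> < t)"
proof -
  let ?S = "{card \<G> |\<G>. \<G> \<subseteq> \<F> \<and> disjoint \<G>}"
  have "finite ?S"
    using assms by (auto intro: finite_subset[of _ "card ` Pow \<F>"])
  moreover have "card ({} :: 'a set set) \<in> ?S"
    by (force simp: disjoint_def)
  ultimately have "Max ?S < t \<longleftrightarrow> (\<forall>x\<in>?S. x < t)"
    by (intro Max_less_iff) auto
  then show ?thesis
    unfolding matching_number_def by blast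
qed

text \<open>\<open>LEAST\<close> is informative only for a satisfiable predicate; the finite cover
  \<open>X\<close> ensures this. Later \<open>X\<close> is the ground set.\<close>

lemma covering_number_ge_iff:
  assumes "finite X" "\<And>F. F \<in> \<F> \<Longrightarrow> F \<inter> X \<noteq> {}"
  shows "t \<le> covering_number \<F> \<longleftrightarrow>
         (\<forall>Y. finite Y \<and> (\<forall>F\<in>\<F>. F \<inter> Y \<noteq> {}) \<longrightarrow> t \<le> card Y)"
proof -
  let ?P = "\<lambda>m. \<exists>Y. finite Y \<and> card Y = m \<and> (\<forall>F\<in>\<F>. F \<inter> Y \<noteq> {})"
  have "?P (covering_number \<F>)"
    unfolding covering_number_def using assms by (intro LeastI[of ?P "card X"]) auto
  moreover have "covering_number \<F> \<le> m" if "?P m" for m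
    unfolding covering_number_def using that by (rule Least_le)
  ultimately show ?thesis
    by (metis order_trans)
qed

lemma nsets_meets_ground:
  assumes "F \<in> nsets A k" "k > 0"
  shows "F \<inter> A \<noteq> {}"
  using assms by (auto simp: nsets_def Int_absorb2)

section \<open>Families bounded by \<open>h\<close>, and small covers of larger families\<close>

lemma card_le_h:
  assumes "\<F> \<subseteq> nsets {1..n} k" "matching_number \<F> < t" "t \<le> covering_number \<F>"
  shows "card \<F> \<le> h n k t"
proof -
  have "finite {card \<F> |\<F>. \<F> \<subseteq> nsets {1..n} k \<and>
      matching_number \<F> < t \<and> covering_number \<F> \<ge> t}"
    by (rule finite_subset[of _ "card ` Pow (nsets {1..n} k)"]) auto
  then show ?thesis
    unfolding h_def using assms by (intro Max_ge) auto
qed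

text \<open>The bounds on \<open>matching_number\<close> and \<open>covering_number\<close> use that two sets
  sharing at least two points with the three-element set \<open>T\<close> intersect.\<close>

lemma card_star_triangle_le_h:
  fixes Y T :: "nat set"
  assumes "t \<ge> 2" "k \<ge> 2" "t + k \<le> n + 1"
    and Y: "Y \<in> nsets {1..n} (t - 2)" and T: "T \<in> nsets {1..n} 3" and "T \<inter> Y = {}"
  shows "card {F \<in> nsets {1..n} k. F \<inter> Y \<noteq> {} \<or> card (F \<inter> T) \<ge> 2} \<le> h n k t"
    (is "card ?G \<le> _")
proof (rule card_le_h)
  show "?G \<subseteq> nsets {1..n} k"
    by blast
  have fin: "finite Y" "finite T" "card Y = t - 2" "card T = 3" "Y \<subseteq> {1..n}" "T \<subseteq> {1..n}"
    using Y T by (auto simp: nsets_def)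
  have finG: "finite ?G"
    by simp
  show "matching_number ?G < t"
    unfolding matching_number_less_iff[OF finG]
  proof (intro allI impI)
    fix \<G> assume \<G>: "\<G> \<subseteq> ?G" "disjoint \<G>"
    let ?A = "{F \<in> \<G>. F \<inter> Y \<noteq> {}}" and ?B = "{F \<in> \<G>. F \<inter> Y = {}}"
    have "finite \<G>"
      using \<G>(1) finG by (rule finite_subset)
    have "card ?A \<le> card Y"
      using \<G>(2) fin by (intro card_disjoint_le_cover) (auto simp: disjoint_def)
    moreover have "card ?B \<le> 1"
    proof -
      have "F = F'" if "F \<in> ?B" "F' \<in> ?B" for F F'
      proof (rule ccontr)
        assume "F \<noteq> F'"
        then have "F \<inter> F' = {}"
          using that \<G>(2) by (auto simp: disjoint_def)
        then have "card (F \<inter> T) + card (F' \<inter> T) = card ((F \<inter> T) \<union> (F' \<inter> T))"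
          using fin by (subst card_Un_disjoint) auto
        also have "\<dots> \<le> card T"
          using fin by (intro card_mono) auto
        finally have "card (F \<inter> T) + card (F' \<inter> T) \<le> 3"
          using fin by simp
        moreover have "card (F \<inter> T) \<ge> 2" "card (F' \<inter> T) \<ge> 2"
          using that \<G>(1) by auto
        ultimately show False
          by linarith
      qed
      then show ?thesis
        using \<open>finite \<G>\<close> by (simp add: card_le_Suc0_iff_eq)
    qed
    moreover have "card \<G> \<le> card ?A + card ?B"
    proof -
      have "?A \<union> ?B = \<G>" by blast
      then show ?thesis using card_Un_le[of ?A ?B] by simp
    qed
    ultimately show "card \<G> < t"
      using fin \<open>t \<ge> 2\<close> by linarith
  qed
  have ground: "F \<inter> {1..n} \<noteq> {}" if "F \<in> ?G" for F
    using that \<open>k \<ge> 2\<close> nsets_meets_ground[of F "{1..n}" k] by simp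
  show "t \<le> covering_number ?G"
  proof (subst covering_number_ge_iff[of "{1..n}"], simp, erule ground, intro allI impI, rule ccontr)
    fix Z assume Z: "finite Z \<and> (\<forall>F\<in>?G. F \<inter> Z \<noteq> {})" and "\<not> t \<le> card Z"
    then have room: "card Z + k \<le> n" and "card Z \<le> t - 1"
      using assms by auto
    \<comment> \<open>A \<open>k\<close>-set through a point of \<open>Y\<close> missed by
      \<open>Z\<close> could avoid \<open>Z\<close>. Once \<open>Z\<close> contains
      \<open>Y\<close>, at most one of its points lies in \<open>T\<close>, so a
      \<open>k\<close>-set through two other points of \<open>T\<close> escapes
      \<open>Z\<close>.\<close>
    have "Y \<subseteq> Z"
    proof
      fix y assume "y \<in> Y"
      show "y \<in> Z"
      proof (rule ccontr)
        assume "y \<notin> Z"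
        then have "{y} \<subseteq> {1..n}" "{y} \<inter> Z = {}" "card {y} \<le> k"
          using \<open>y \<in> Y\<close> fin(5) \<open>k \<ge> 2\<close> by auto
        then obtain F where "F \<in> nsets {1..n} k" "{y} \<subseteq> F" "F \<inter> Z = {}"
          using nsets_extending_exists room Z by metis
        with Z \<open>y \<in> Y\<close> show False by blast
      qed
    qed
    then have "card (Z - Y) \<le> 1"
      using fin Z \<open>card Z \<le> t - 1\<close> by (subst card_Diff_subset) auto
    moreover have "card (T \<inter> Z) \<le> card (Z - Y)"
      using Z \<open>T \<inter> Y = {}\<close> by (intro card_mono) auto
    ultimately have "card (T - Z) \<ge> 2"
      using fin by (simp add: card_Diff_subset_Int)
    then obtain S where S: "S \<subseteq> T - Z" "card S = 2"
      by (metis obtain_subset_with_card_n)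
    then have "S \<subseteq> {1..n}" "S \<inter> Z = {}" "card S \<le> k"
      using fin \<open>k \<ge> 2\<close> by auto
    then obtain F where F: "F \<in> nsets {1..n} k" "S \<subseteq> F" "F \<inter> Z = {}"
      using nsets_extending_exists room Z by metis
    have "card S \<le> card (F \<inter> T)"
      using S F fin by (intro card_mono) auto
    then have "F \<in> ?G"
      using S F by simp
    with Z F show False by blast
  qed
qed

text \<open>The second families have equal size, and a set avoiding \<open>Y\<close> and
  \<open>Z\<close> also avoids \<open>Z'\<close>. So passing to \<open>Z'\<close> can only enlarge
  the overlap and shrink the union.\<close>

lemma card_nsets_missing_two:
  fixes Y Z Z' :: "nat set"
  assumes "finite A" "Z \<subseteq> A" "Z' \<subseteq> A" "card Z = card Z'" "Z' \<subseteq> Y \<union> Z"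
  shows "card (nsets (A - Y) k \<union> nsets (A - Z') k) \<le> card (nsets (A - Y) k \<union> nsets (A - Z) k)"
proof -
  have fin: "finite (nsets (A - X) k)" for X
    using assms(1) by (simp add: finite_imp_finite_nsets)
  have eq: "card (nsets (A - Z) k) = card (nsets (A - Z') k)"
    using assms by (simp add: card_Diff_subset finite_subset)
  have "card (nsets (A - Y) k \<inter> nsets (A - Z) k) \<le> card (nsets (A - Y) k \<inter> nsets (A - Z') k)"
    using assms fin by (intro card_mono) (auto simp: nsets_def)
  then show ?thesis
    using card_Un_Int[OF fin fin, of Y Z] card_Un_Int[OF fin fin, of Y Z'] eq by linarith
qed

text \<open>Replacing \<open>Z\<close> by \<open>Z'\<close>, which differs from \<open>Y\<close> in one point only, enlarges the family of all sets
  meeting both covers. That family then lies in a star-and-triangle family.\<close>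

lemma two_covers_card_le_h:
  assumes "t \<ge> 2" "k \<ge> 2" "t + k \<le> n + 1"
    and \<F>: "\<F> \<subseteq> nsets {1..n} k"
    and Y: "Y \<in> nsets {1..n} (t - 1)" "\<And>F. F \<in> \<F> \<Longrightarrow> F \<inter> Y \<noteq> {}"
    and Z: "Z \<in> nsets {1..n} (t - 1)" "\<And>F. F \<in> \<F> \<Longrightarrow> F \<inter> Z \<noteq> {}"
    and "Y \<noteq> Z"
  shows "card \<F> \<le> h n k t"
proof -
  have fin: "finite Y" "finite Z" "card Y = t - 1" "card Z = t - 1" "Y \<subseteq> {1..n}" "Z \<subseteq> {1..n}"
    using Y Z by (auto simp: nsets_def)
  have "\<not> Y \<subseteq> Z" "\<not> Z \<subseteq> Y"
    using fin \<open>Y \<noteq> Z\<close> by (metis card_subset_eq)+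
  then obtain y z where yz: "y \<in> Y" "y \<notin> Z" "z \<in> Z" "z \<notin> Y"
    by blast
  define Y' where "Y' = Y - {y}"
  have Y': "Y' \<in> nsets {1..n} (t - 2)" "z \<notin> Y'" "y \<notin> Y'" "Y = insert y Y'"
    using fin yz by (auto simp: Y'_def nsets_def)
  define Z' where "Z' = insert z Y'"
  have "card Z' = card Z" "Z' \<subseteq> {1..n}" "Z' \<subseteq> Y \<union> Z"
    using Y' fin yz \<open>t \<ge> 2\<close> by (auto simp: Z'_def nsets_def)
  then have le: "card (nsets ({1..n} - Y) k \<union> nsets ({1..n} - Z') k)
      \<le> card (nsets ({1..n} - Y) k \<union> nsets ({1..n} - Z) k)"
    using fin by (intro card_nsets_missing_two) auto
  \<comment> \<open>\<open>insert z Y\<close> has \<open>t\<close> points, so one point remains as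
    the third vertex of the triangle.\<close>
  have "card (insert z Y) + 1 \<le> n"
    using fin yz assms(1-3) by simp
  then have "\<not> {1..n} \<subseteq> insert z Y"
    using fin card_mono[of "insert z Y" "{1..n}"] by auto
  then obtain x where x: "x \<in> {1..n}" "x \<notin> insert z Y"
    by blast
  define T where "T = {x, y, z}"
  have T: "T \<in> nsets {1..n} 3" "T \<inter> Y' = {}"
    using x yz fin Y' by (auto simp: T_def nsets_def card_insert_if)
  let ?N = "nsets {1..n} k" and ?G = "{F \<in> nsets {1..n} k. F \<inter> Y' \<noteq> {} \<or> card (F \<inter> T) \<ge> 2}"
  have diff: "card (?N - (nsets ({1..n} - U) k \<union> nsets ({1..n} - V) k))
      = card ?N - card (nsets ({1..n} - U) k \<union> nsets ({1..n} - V) k)" for U V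
    by (intro card_Diff_subset) (auto simp: nsets_def intro: finite_subset[of _ ?N])
  \<comment> \<open>The sets meeting both covers are counted by removing those that avoid at least
    one.\<close>
  have "card \<F> \<le> card (?N - (nsets ({1..n} - Y) k \<union> nsets ({1..n} - Z) k))"
    using \<F> Y(2) Z(2) by (intro card_mono) (auto simp: nsets_def)
  also have "\<dots> \<le> card (?N - (nsets ({1..n} - Y) k \<union> nsets ({1..n} - Z') k))"
    unfolding diff using le by (rule diff_le_mono2)
  also have "\<dots> \<le> card ?G"
  proof (intro card_mono subsetI)
    fix F assume F: "F \<in> ?N - (nsets ({1..n} - Y) k \<union> nsets ({1..n} - Z') k)"
    then have meet: "F \<inter> Y \<noteq> {}" "F \<inter> Z' \<noteq> {}"
      by (auto simp: nsets_def)
    \<comment> \<open>Off \<open>Y'\<close>, the set \<open>F\<close> can meet \<open>Y\<close> only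
      in \<open>y\<close> and \<open>Z'\<close> only in \<open>z\<close>.\<close>
    have "card (F \<inter> T) \<ge> 2" if "F \<inter> Y' = {}"
    proof -
      have "{y, z} \<subseteq> F \<inter> T"
        using that meet Y' by (auto simp: T_def Z'_def)
      moreover have "card {y, z} = 2"
        using yz by (simp add: card_insert_if) auto
      moreover have "finite (F \<inter> T)"
        by (simp add: T_def)
      ultimately show ?thesis by (metis card_mono)
    qed
    then show "F \<in> ?G"
      using F by auto
  qed simp
  also have "\<dots> \<le> h n k t"
    using assms(1-3) Y'(1) T by (rule card_star_triangle_le_h)
  finally show ?thesis .
qed

text \<open>Being larger than \<open>h\<close> forces the covering number below \<open>t\<close>. A
  cover with fewer than \<open>t\<close> points is cut down to the ground set and padded to exactly
  \<open>t - 1\<close> points.\<close>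

lemma cover_exists_of_card_gt_h:
  assumes "k \<ge> 1" "t \<ge> 1" "t \<le> n + 1"
    and \<F>: "\<F> \<subseteq> nsets {1..n} k" "matching_number \<F> < t" "h n k t < card \<F>"
  obtains Y where "Y \<in> nsets {1..n} (t - 1)" "\<And>F. F \<in> \<F> \<Longrightarrow> F \<inter> Y \<noteq> {}"
proof -
  have "F \<inter> {1..n} \<noteq> {}" if "F \<in> \<F>" for F
    using that \<F>(1) \<open>k \<ge> 1\<close> nsets_meets_ground[of F "{1..n}" k] by auto
  moreover have "\<not> t \<le> covering_number \<F>"
    using card_le_h[OF \<F>(1,2)] \<F>(3) by linarith
  ultimately obtain Z where Z: "finite Z" "\<And>F. F \<in> \<F> \<Longrightarrow> F \<inter> Z \<noteq> {}" "card Z < t"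
    using covering_number_ge_iff[of "{1..n}" \<F> t] by (auto simp: not_le)
  have "card (Z \<inter> {1..n}) \<le> card Z"
    using Z by (intro card_mono) auto
  then have "card (Z \<inter> {1..n}) \<le> t - 1" "t - 1 \<le> card {1..n}"
    using Z(3) assms(3) by auto
  then obtain Y where Y: "Z \<inter> {1..n} \<subseteq> Y" "Y \<subseteq> {1..n}" "card Y = t - 1"
    using exists_subset_between[OF _ _ Int_lower2 finite_atLeastAtMost] by metis
  show thesis
  proof (rule that)
    show "Y \<in> nsets {1..n} (t - 1)"
      using Y by (auto simp: nsets_def intro: finite_subset)
    show "F \<inter> Y \<noteq> {}" if "F \<in> \<F>" for F
      using Z(2)[OF that] that \<F>(1) Y(1) by (fastforce simp: nsets_def)
  qed
qed

section \<open>Rainbow matchings indexed by colours\<close>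

text \<open>Indexing the sets by their colours makes the colours distinct automatically and lets
  single sets be exchanged by function update.\<close>

definition is_rainbow :: "('c \<Rightarrow> 'a set set) \<Rightarrow> 'c set \<Rightarrow> ('c \<Rightarrow> 'a set) \<Rightarrow> bool" where
  "is_rainbow C L r \<longleftrightarrow> finite L \<and> (\<forall>j\<in>L. r j \<in> C j) \<and> disjoint_family_on r L"

definition rainbow_free :: "('c \<Rightarrow> 'a set set) \<Rightarrow> 'c set \<Rightarrow> nat \<Rightarrow> bool" where
  "rainbow_free C K m \<longleftrightarrow> (\<forall>L r. L \<subseteq> K \<and> card L = m \<longrightarrow> \<not> is_rainbow C L r)"

lemma is_rainbow_insert:
  assumes "is_rainbow C L r" "F \<in> C i" "i \<notin> L" "\<And>j. j \<in> L \<Longrightarrow> F \<inter> r j = {}"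
  shows "is_rainbow C (insert i L) (r(i := F))"
  using assms unfolding is_rainbow_def disjoint_family_on_def by auto

lemma is_rainbow_subset:
  "is_rainbow C L r \<Longrightarrow> L' \<subseteq> L \<Longrightarrow> is_rainbow C L' r"
  unfolding is_rainbow_def by (blast intro: finite_subset disjoint_family_on_mono)

text \<open>A set disjoint from a largest rainbow matching must repeat one of its colours; colours
  are forced this way below.\<close>

lemma rainbow_extension_colour:
  assumes "rainbow_free C K (Suc m)" "is_rainbow C L r" "L \<subseteq> K" "card L = m"
    and "F \<in> C i" "i \<in> K" "\<And>j. j \<in> L \<Longrightarrow> F \<inter> r j = {}"
  shows "i \<in> L"
proof (rule ccontr)
  assume "i \<notin> L"
  with assms have "is_rainbow C (insert i L) (r(i := F))"
    by (intro is_rainbow_insert)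
  moreover have "card (insert i L) = Suc m"
    using assms \<open>i \<notin> L\<close> by (simp add: is_rainbow_def)
  ultimately show False
    using assms by (auto simp: rainbow_free_def)
qed

section \<open>Colourings and systems of representatives\<close>

locale uniform_colouring =
  fixes n k :: nat and I :: "'c set" and C :: "'c \<Rightarrow> nat set set"
  assumes finite_colours: "finite I"
    and nonempty_class: "\<And>j. j \<in> I \<Longrightarrow> C j \<noteq> {}"
    and disjoint_classes: "disjoint_family_on C I"
    and classes_cover: "(\<Union>j\<in>I. C j) = nsets {1..n} k"
    and k_ge_2: "k \<ge> 2"
begin

lemma class_memberD:
  assumes "F \<in> C j" "j \<in> I"
  shows "F \<in> nsets {1..n} k" "finite F" "card F = k" "F \<subseteq> {1..n}" "F \<noteq> {}"
proof -
  show *: "F \<in> nsets {1..n} k"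
    using assms classes_cover by blast
  then show "finite F" "card F = k" "F \<subseteq> {1..n}"
    by (auto simp: nsets_def)
  then show "F \<noteq> {}"
    using k_ge_2 by auto
qed

lemma colour_exists:
  assumes "F \<in> nsets {1..n} k"
  obtains j where "j \<in> I" "F \<in> C j"
  using assms classes_cover by blast

lemma colour_unique:
  "F \<in> C i \<Longrightarrow> F \<in> C j \<Longrightarrow> i \<in> I \<Longrightarrow> j \<in> I \<Longrightarrow> i = j"
  using disjoint_classes unfolding disjoint_family_on_def by blast

lemma representatives_exist:
  assumes "K \<subseteq> I"
  obtains r where "\<And>j. j \<in> K \<Longrightarrow> r j \<in> C j"
proof -
  have "\<forall>j\<in>K. \<exists>F. F \<in> C j"
    using assms nonempty_class by blast
  then show thesis
    using that by metis
qed

lemma inj_on_representatives: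
  assumes "K \<subseteq> I" "\<And>j. j \<in> K \<Longrightarrow> r j \<in> C j"
  shows "inj_on r K"
proof (rule inj_onI)
  fix i j assume "i \<in> K" "j \<in> K" "r i = r j"
  then show "i = j"
    using assms(2)[of i] assms(2)[of j] assms(1) colour_unique[of "r i" i j] by auto
qed

lemma card_Union_rainbow_le:
  assumes "is_rainbow C L r" "L \<subseteq> I"
  shows "finite (\<Union>(r ` L))" "card (\<Union>(r ` L)) \<le> card L * k"
proof -
  have r: "finite (r j)" "card (r j) = k" if "j \<in> L" for j
    using that assms class_memberD[of "r j" j] by (auto simp: is_rainbow_def)
  have "finite L"
    using assms by (simp add: is_rainbow_def)
  with r show "finite (\<Union>(r ` L))"
    by blast
  have "card (\<Union>(r ` L)) \<le> (\<Sum>j\<in>L. card (r j))"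
    using \<open>finite L\<close> by (rule card_UN_le)
  then show "card (\<Union>(r ` L)) \<le> card L * k"
    using r by simp
qed

text \<open>Disjoint classes make \<open>r\<close> injective on \<open>K\<close>. Hence a disjoint
  subfamily with at least \<open>t\<close> members, cut down to exactly \<open>t\<close>, pulls back
  to a rainbow matching.\<close>

lemma matching_number_representatives:
  assumes "rainbow_free C K t" "K \<subseteq> I" "\<And>j. j \<in> K \<Longrightarrow> r j \<in> C j"
  shows "matching_number (r ` K) < t"
proof -
  have "finite K"
    using assms(2) finite_colours finite_subset by blast
  have "card \<G> < t" if \<G>: "\<G> \<subseteq> r ` K" "disjoint \<G>" for \<G>
  proof (rule ccontr)
    assume "\<not> card \<G> < t"
    then obtain \<H> where \<H>: "\<H> \<subseteq> \<G>" "card \<H> = t"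
      by (metis not_less obtain_subset_with_card_n)
    then obtain L where L: "L \<subseteq> K" "\<H> = r ` L"
      using \<G>(1) by (metis subset_image_iff subset_trans)
    have inj: "inj_on r L"
      using inj_on_representatives[of K r] assms L(1) inj_on_subset by blast
    have "disjoint (r ` L)"
      using L(2) \<H>(1) \<G>(2) by (auto simp: disjoint_def)
    then have "disjoint_family_on r L"
      using inj unfolding disjoint_family_on_def disjoint_def
      by (metis imageI inj_on_contraD)
    then have "is_rainbow C L r"
      using L assms(3) \<open>finite K\<close> finite_subset by (auto simp: is_rainbow_def)
    moreover have "card L = t"
      using \<H> L inj by (simp add: card_image)
    ultimately show False
      using assms(1) L by (auto simp: rainbow_free_def)
  qed
  then show ?thesis
    using \<open>finite K\<close> by (simp add: matching_number_less_iff)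
qed

section \<open>Common covers of many classes, and colours forced by rainbow matchings\<close>

lemma common_cover_unique:
  assumes "t \<ge> 2" "t + k \<le> n + 1" "K \<subseteq> I" "h n k t < card K"
    and r: "\<And>j. j \<in> K \<Longrightarrow> r j \<in> C j"
    and Y: "Y \<in> nsets {1..n} (t - 1)" "\<And>j. j \<in> K \<Longrightarrow> r j \<inter> Y \<noteq> {}"
    and Z: "Z \<in> nsets {1..n} (t - 1)" "\<And>j. j \<in> K \<Longrightarrow> r j \<inter> Z \<noteq> {}"
  shows "Y = Z"
proof (rule ccontr)
  assume "Y \<noteq> Z"
  have "r ` K \<subseteq> nsets {1..n} k"
    using r assms(3) class_memberD(1) by blast
  then have "card (r ` K) \<le> h n k t"
    using assms(1,2) k_ge_2 Y Z \<open>Y \<noteq> Z\<close>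
    by (intro two_covers_card_le_h[of t k n "r ` K" Y Z]) blast+
  moreover have "card (r ` K) = card K"
    using inj_on_representatives[OF assms(3) r] by (simp add: card_image)
  ultimately show False
    using assms(4) by simp
qed

text \<open>The summand 2 lets the representatives outnumber \<open>h\<close> even after colour
  \<open>i\<close> is dropped. The covers before and after changing \<open>r i\<close> both cover
  the representatives of \<open>K - {i}\<close>, so they agree.\<close>

lemma common_cover_exists:
  assumes "t \<ge> 2" "t + k \<le> n + 1" "K \<subseteq> I" "h n k t + 2 \<le> card K" "rainbow_free C K t"
  obtains Y where "Y \<in> nsets {1..n} (t - 1)" "\<And>j F. j \<in> K \<Longrightarrow> F \<in> C j \<Longrightarrow> F \<inter> Y \<noteq> {}"
proof -
  have cover: "\<exists>Y \<in> nsets {1..n} (t - 1). \<forall>j\<in>K. r j \<inter> Y \<noteq> {}"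
    if r: "\<And>j. j \<in> K \<Longrightarrow> r j \<in> C j" for r
  proof -
    have "r ` K \<subseteq> nsets {1..n} k"
      using r assms(3) class_memberD(1) by blast
    moreover have "matching_number (r ` K) < t"
      using assms(3,5) r by (intro matching_number_representatives)
    moreover have "h n k t < card (r ` K)"
      using inj_on_representatives[OF assms(3) r] assms(4) by (simp add: card_image)
    ultimately obtain Y where "Y \<in> nsets {1..n} (t - 1)" "\<And>F. F \<in> r ` K \<Longrightarrow> F \<inter> Y \<noteq> {}"
      using cover_exists_of_card_gt_h[of k t n "r ` K"] k_ge_2 assms(1,2) by auto
    then show ?thesis by blast
  qed
  obtain r where r: "\<And>j. j \<in> K \<Longrightarrow> r j \<in> C j"
    using representatives_exist[OF assms(3)] by blast
  obtain Y where Y: "Y \<in> nsets {1..n} (t - 1)" "\<And>j. j \<in> K \<Longrightarrow> r j \<inter> Y \<noteq> {}"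
    using cover[OF r] by blast
  show thesis
  proof (rule that[OF Y(1)])
    fix i F assume iF: "i \<in> K" "F \<in> C i"
    let ?r = "r(i := F)"
    have r': "?r j \<in> C j" if "j \<in> K" for j
      using that r iF by auto
    obtain Z where Z: "Z \<in> nsets {1..n} (t - 1)" "\<And>j. j \<in> K \<Longrightarrow> ?r j \<inter> Z \<noteq> {}"
      using cover[OF r'] by blast
    have rZ: "r j \<inter> Z \<noteq> {}" if "j \<in> K - {i}" for j
      using Z(2)[of j] that by auto
    have "Y = Z"
    proof (rule common_cover_unique[of t "K - {i}" r])
      show "h n k t < card (K - {i})"
        using assms(4) iF by simp
    qed (use assms(1-3) r Y Z(1) rZ in auto)
    with Z(2)[OF iF(1)] show "F \<inter> Y \<noteq> {}"
      by simp
  qed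
qed

text \<open>Two rainbow matchings of size \<open>m\<close> with disjoint colour sets leave room for one more \<open>k\<close>-set,
  because every member of one of them meets the union of the other. The colour of that set
  would have to occur in both matchings.\<close>

lemma rainbow_free_complement:
  assumes "rainbow_free C I (Suc m)" "is_rainbow C L r" "L \<subseteq> I" "card L = m"
    and "n \<ge> Suc m * k + m * (k - 1)"
  shows "rainbow_free C (I - L) m"
  unfolding rainbow_free_def
proof (intro allI impI notI)
  fix L' r' assume L': "L' \<subseteq> I - L \<and> card L' = m" and r': "is_rainbow C L' r'"
  let ?W = "\<Union>(r ` L)" and ?V = "\<Union>j\<in>L'. r' j - \<Union>(r ` L)"
  have "finite L'"
    using r' by (simp add: is_rainbow_def)
  have part: "finite (r' j - ?W) \<and> card (r' j - ?W) \<le> k - 1" if "j \<in> L'" for j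
  proof -
    have j: "r' j \<in> C j" "j \<in> I" "j \<notin> L"
      using that L' r' by (auto simp: is_rainbow_def)
    note F = class_memberD[OF j(1,2)]
    have "r' j \<inter> ?W \<noteq> {}"
      using rainbow_extension_colour[OF assms(1-4) j(1,2)] j(3) by blast
    then have "r' j - ?W \<subset> r' j"
      by blast
    then have "card (r' j - ?W) < k"
      using psubset_card_mono[OF F(2)] F(3) by simp
    then show ?thesis
      using F(2) by simp
  qed
  \<comment> \<open>Each \<open>r' j\<close> shares a point with \<open>?W\<close> and adds at most
    \<open>k - 1\<close> points. The two matchings occupy at most \<open>m * k + m * (k - 1)\<close>
    points, so the bound on \<open>n\<close> leaves at least \<open>k\<close> free.\<close>
  have "card ?V \<le> (\<Sum>j\<in>L'. card (r' j - ?W))"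
    using \<open>finite L'\<close> by (rule card_UN_le)
  also have "\<dots> \<le> (\<Sum>j\<in>L'. k - 1)"
    using part by (intro sum_mono) blast
  finally have "card ?V \<le> m * (k - 1)"
    using L' by simp
  moreover have W: "finite ?W" "card ?W \<le> m * k"
    using card_Union_rainbow_le[OF assms(2,3)] assms(4) by auto
  ultimately have "card (?W \<union> ?V) + k \<le> n"
    using card_Un_le[of ?W ?V] assms(5) by simp
  moreover have "finite (?W \<union> ?V)"
    using W part \<open>finite L'\<close> by blast
  ultimately obtain F where F: "F \<in> nsets {1..n} k" "F \<inter> (?W \<union> ?V) = {}"
    using nsets_avoiding_exists by blast
  obtain i where i: "i \<in> I" "F \<in> C i"
    using colour_exists F(1) .
  have "i \<in> L"
    using assms F by (intro rainbow_extension_colour[OF assms(1-4) i(2,1)]) blast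
  moreover have "i \<in> L'"
    using L' F by (intro rainbow_extension_colour[OF assms(1) r' _ _ i(2,1)]) auto
  ultimately show False
    using L' by blast
qed

text \<open>Here \<open>P\<close> is the union of the \<open>m\<close> sets with colours in \<open>K\<close> of a rainbow matching on \<open>insert i K\<close>.
  A set \<open>F\<close> off \<open>P\<close> of another colour, a set \<open>G\<close> of colour \<open>i\<close> off \<open>P \<union> F\<close> and these \<open>m\<close> sets would form
  a rainbow matching of size \<open>m + 2\<close>.\<close>

lemma uncovered_colour_dominates:
  assumes free: "rainbow_free C I (Suc (Suc m))" and freeK: "rainbow_free C K (Suc m)"
    and "m \<ge> 1" and n: "n \<ge> Suc (Suc m) * k + Suc m * (k - 1)"
    and K: "K \<subseteq> I" "h n k (Suc m) + 2 \<le> card K"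
    and Y: "Y \<in> nsets {1..n} m" "\<And>j F. j \<in> K \<Longrightarrow> F \<in> C j \<Longrightarrow> F \<inter> Y \<noteq> {}"
    and i: "i \<in> I - K" "\<exists>F\<in>C i. F \<inter> Y = {}"
  obtains P where "finite P" "card P \<le> m * k" "Y \<subseteq> P"
    "\<And>F. F \<in> nsets {1..n} k \<Longrightarrow> F \<inter> P = {} \<Longrightarrow> F \<in> C i"
proof -
  have "m \<le> m * k" "Suc (Suc m) * k = 2 * k + m * k"
    using k_ge_2 by simp_all
  then have room: "Suc m + k \<le> n + 1"
    using n k_ge_2 by linarith
  have "finite K"
    using K(1) finite_colours finite_subset by blast
  \<comment> \<open>Otherwise \<open>insert i K\<close> has a common \<open>m\<close>-point cover
    \<open>Z\<close>. It also covers \<open>K\<close>, so it equals \<open>Y\<close>, which misses a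
    set of colour \<open>i\<close>.\<close>
  have "\<not> rainbow_free C (insert i K) (Suc m)"
  proof
    assume f: "rainbow_free C (insert i K) (Suc m)"
    have "h n k (Suc m) + 2 \<le> card (insert i K)"
      using K(2) card_insert_le[of K i] by linarith
    then obtain Z where Z: "Z \<in> nsets {1..n} m"
        "\<And>j F. j \<in> insert i K \<Longrightarrow> F \<in> C j \<Longrightarrow> F \<inter> Z \<noteq> {}"
      using common_cover_exists[of "Suc m" "insert i K"] f room \<open>m \<ge> 1\<close> K(1) i(1) by auto
    obtain r where r: "\<And>j. j \<in> K \<Longrightarrow> r j \<in> C j"
      using representatives_exist[OF K(1)] by blast
    have "r j \<inter> Y \<noteq> {}" "r j \<inter> Z \<noteq> {}" if "j \<in> K" for j
      using that r Y(2) Z(2) by blast+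
    then have "Y = Z"
      using \<open>m \<ge> 1\<close> room K r Y(1) Z(1)
      by (intro common_cover_unique[of "Suc m" K r]) simp_all
    with Z i show False by blast
  qed
  then obtain L0 r where L0: "L0 \<subseteq> insert i K" "card L0 = Suc m" and r0: "is_rainbow C L0 r"
    unfolding rainbow_free_def by blast
  have "i \<in> L0"
    using freeK L0 r0 by (auto simp: rainbow_free_def)
  define L where "L = L0 - {i}"
  have "finite L0"
    using r0 by (simp add: is_rainbow_def)
  have L: "L \<subseteq> K" "card L = m" "L \<subseteq> I" and L0_eq: "L0 = insert i L" "i \<notin> L"
    using L0 \<open>i \<in> L0\<close> \<open>finite L0\<close> K(1) by (auto simp: L_def)
  have rL: "is_rainbow C L r"
    using r0 by (rule is_rainbow_subset) (simp add: L0_eq subset_insertI)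
  have rC: "r j \<in> C j" if "j \<in> L0" for j
    using that r0 by (simp add: is_rainbow_def)
  define P where "P = \<Union>(r ` L)"
  have P: "finite P" "card P \<le> m * k"
    using card_Union_rainbow_le[OF rL L(3)] L(2) by (auto simp: P_def)
  have "Y \<subseteq> P"
    unfolding P_def
  proof (rule tight_cover_subset_Union)
    have "inj_on r L"
      using inj_on_representatives[OF L(3)] rC L0_eq by blast
    then show "card (r ` L) = card Y"
      using L Y(1) by (simp add: card_image nsets_def)
    show "disjoint (r ` L)"
      using rL by (intro disjoint_family_on_disjoint_image) (simp add: is_rainbow_def)
    show "finite Y"
      using Y(1) by (simp add: nsets_def)
    show "F \<inter> Y \<noteq> {}" if "F \<in> r ` L" for F
      using that Y(2) rC L(1) L0_eq(1) by blast
  qed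
  \<comment> \<open>A set off \<open>P\<close> misses \<open>Y\<close>, which meets every set with a
    colour in \<open>K\<close>.\<close>
  have offK: "j \<notin> K" if "F \<in> C j" "F \<inter> P = {}" for j F
    using that Y(2)[of j F] \<open>Y \<subseteq> P\<close> by blast
  have "F \<in> C i" if F: "F \<in> nsets {1..n} k" "F \<inter> P = {}" for F
  proof (rule ccontr)
    assume "F \<notin> C i"
    obtain j where j: "j \<in> I" "F \<in> C j"
      using colour_exists F(1) .
    have ri: "finite (r i)" "card (r i) = k"
      using class_memberD[of "r i" i] rC \<open>i \<in> L0\<close> i(1) by auto
    have "card (P \<union> r i \<union> F) \<le> m * k + k + k"
      using card_Un_le[of "P \<union> r i" F] card_Un_le[of P "r i"] P ri class_memberD[OF j(2,1)]
      by linarith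
    \<comment> \<open>Besides \<open>P\<close> there must be room for three \<open>k\<close>-sets:
      \<open>r i\<close>, \<open>F\<close> and \<open>G\<close>. The main term of the bound on
      \<open>n\<close> provides two, this estimate the third.\<close>
    moreover have "k \<le> Suc m * (k - 1)"
    proof -
      have "k \<le> 2 * (k - 1)"
        using k_ge_2 by linarith
      also have "\<dots> \<le> Suc m * (k - 1)"
        using \<open>m \<ge> 1\<close> by (intro mult_le_mono1) simp
      finally show ?thesis .
    qed
    ultimately have "card (P \<union> r i \<union> F) + k \<le> n"
      using n by simp
    then obtain G where G: "G \<in> nsets {1..n} k" "G \<inter> (P \<union> r i \<union> F) = {}"
      using nsets_avoiding_exists[of "P \<union> r i \<union> F" k n] P ri class_memberD[OF j(2,1)] by auto
    obtain l where l: "l \<in> I" "G \<in> C l"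
      using colour_exists G(1) .
    \<comment> \<open>\<open>G\<close> avoids the whole matching on \<open>L0\<close>, so its colour
      is in \<open>L0\<close>; being off \<open>P\<close>, it can only be \<open>i\<close>. Thus
      \<open>G\<close> may replace \<open>r i\<close>, which \<open>F\<close> might meet.\<close>
    have "l \<in> L0"
    proof (rule rainbow_extension_colour[OF free r0 _ L0(2) l(2,1)])
      show "L0 \<subseteq> I"
        using L0 K(1) i by blast
      show "G \<inter> r q = {}" if "q \<in> L0" for q
        using that G(2) by (auto simp: L0_eq P_def)
    qed
    then have "G \<in> C i"
      using offK[OF l(2)] G(2) L l(2) L0_eq by blast
    then have GL: "is_rainbow C (insert i L) (r(i := G))"
      using G(2) L0_eq by (intro is_rainbow_insert[OF rL]) (auto simp: P_def)
    have "j \<in> insert i L"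
    proof (rule rainbow_extension_colour[OF free GL _ _ j(2,1)])
      show "insert i L \<subseteq> I" "card (insert i L) = Suc m"
        using L0 K(1) i L0_eq by auto
      show "F \<inter> (r(i := G)) q = {}" if "q \<in> insert i L" for q
        using that G(2) F(2) L0_eq by (auto simp: P_def)
    qed
    then show False
      using offK[OF j(2) F(2)] \<open>F \<notin> C i\<close> j(2) L by blast
  qed
  with P \<open>Y \<subseteq> P\<close> show thesis
    using that by blast
qed

section \<open>The dichotomy for colourings\<close>

lemma star_like_or_few_colours:
  assumes free: "rainbow_free C I (Suc (Suc m))"
    and "m \<ge> 1" and n: "n \<ge> Suc (Suc m) * k + Suc m * (k - 1)"
    and many: "h n k (Suc m) + Suc (Suc m) < card I"
  shows "\<exists>Y\<in>nsets {1..n} m. \<exists>i\<in>I. \<forall>j\<in>I - {i}. \<forall>F\<in>C j. F \<inter> Y \<noteq> {}"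
proof -
  have "m \<le> m * k" "Suc (Suc m) * k = 2 * k + m * k"
    using k_ge_2 by simp_all
  then have room: "Suc m + k \<le> n + 1"
    using n k_ge_2 by linarith
  obtain K where K: "K \<subseteq> I" "h n k (Suc m) + 2 \<le> card K" "rainbow_free C K (Suc m)"
  proof (cases "rainbow_free C I (Suc m)")
    case True
    then show ?thesis
      using that[of I] many by simp
  next
    case False
    then obtain L r where L: "L \<subseteq> I" "card L = Suc m" and r: "is_rainbow C L r"
      unfolding rainbow_free_def by blast
    \<comment> \<open>More than \<open>h n k (Suc m) + m + 2\<close> colours, less
      \<open>m + 1\<close>, leave at least \<open>h n k (Suc m) + 2\<close>.\<close>
    have "card (I - L) = card I - Suc m"
      using L finite_colours by (simp add: card_Diff_subset finite_subset)
    then show ?thesis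
      using that[of "I - L"] rainbow_free_complement[OF free r L n] many by simp
  qed
  then obtain Y where Y: "Y \<in> nsets {1..n} m" "\<And>j F. j \<in> K \<Longrightarrow> F \<in> C j \<Longrightarrow> F \<inter> Y \<noteq> {}"
    using common_cover_exists[of "Suc m" K] room \<open>m \<ge> 1\<close> by auto
  \<comment> \<open>The set \<open>Y\<close> witnesses star-likeness once \<open>U\<close> has at
    most one element.\<close>
  define U where "U = {i \<in> I. \<exists>F\<in>C i. F \<inter> Y = {}}"
  have "i = i'" if ii: "i \<in> U" "i' \<in> U" for i i'
  proof -
    have dom: "\<exists>P. finite P \<and> card P \<le> m * k \<and> Y \<subseteq> P \<and>
        (\<forall>F\<in>nsets {1..n} k. F \<inter> P = {} \<longrightarrow> F \<in> C j)" if "j \<in> U" for j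
    proof -
      have j: "j \<in> I - K" "\<exists>F\<in>C j. F \<inter> Y = {}"
        using that Y(2) by (auto simp: U_def)
      show ?thesis
      proof (rule uncovered_colour_dominates[OF free K(3) \<open>m \<ge> 1\<close> n K(1,2) Y(1) _ j])
        show "F \<inter> Y \<noteq> {}" if "l \<in> K" "F \<in> C l" for l F
          using that by (rule Y(2))
        show ?thesis
          if "finite P" "card P \<le> m * k" "Y \<subseteq> P"
            "\<And>F. F \<in> nsets {1..n} k \<Longrightarrow> F \<inter> P = {} \<Longrightarrow> F \<in> C j" for P
          using that by (intro exI[of _ P]) simp
      qed
    qed
    obtain P where P: "finite P" "card P \<le> m * k" "Y \<subseteq> P"
        "\<forall>F\<in>nsets {1..n} k. F \<inter> P = {} \<longrightarrow> F \<in> C i"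
      using dom[OF ii(1)] by blast
    obtain Q where Q: "finite Q" "card Q \<le> m * k" "Y \<subseteq> Q"
        "\<forall>F\<in>nsets {1..n} k. F \<inter> Q = {} \<longrightarrow> F \<in> C i'"
      using dom[OF ii(2)] by blast
    have "card Y = m"
      using Y(1) by (simp add: nsets_def)
    \<comment> \<open>Both sets contain \<open>Y\<close>. This overlap saves \<open>m\<close>
      points, so a \<open>k\<close>-set avoiding both fits; it would have both colours.\<close>
    then have "m \<le> card (P \<inter> Q)"
      using P Q by (metis card_mono finite_Int le_inf_iff)
    then have "card (P \<union> Q) + m \<le> m * k + m * k"
      using card_Un_Int[OF P(1) Q(1)] P(2) Q(2) by linarith
    moreover have "m * k + m * k + k \<le> n + m"
    proof -
      have "m * (k - 1) + m = m * k"
        using k_ge_2 by (cases k) auto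
      then show ?thesis
        using n by simp
    qed
    ultimately have "card (P \<union> Q) + k \<le> n"
      by linarith
    then obtain F where "F \<in> nsets {1..n} k" "F \<inter> (P \<union> Q) = {}"
      using nsets_avoiding_exists[of "P \<union> Q" k n] P Q by blast
    then have "F \<in> C i" "F \<in> C i'"
      using P(4) Q(4) by blast+
    then show "i = i'"
      using colour_unique ii by (auto simp: U_def)
  qed
  \<comment> \<open>If \<open>U\<close> is empty, any colour serves as the exceptional one.\<close>
  moreover obtain i0 where "i0 \<in> I"
    using many by fastforce
  ultimately obtain i where "i \<in> I" "U \<subseteq> {i}"
    unfolding U_def by blast
  then have "\<forall>j\<in>I - {i}. \<forall>F\<in>C j. F \<inter> Y \<noteq> {}"
    by (auto simp: U_def)
  with Y(1) \<open>i \<in> I\<close> show ?thesis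
    by blast
qed

end

section \<open>Transfer to matchings given as families of sets\<close>

text \<open>Nonempty disjoint sets are distinct, so the image keeps the size of \<open>L\<close>,
  and the inverse of \<open>r\<close> recovers the colours.\<close>

lemma rainbow_matching_image:
  assumes "is_rainbow C L r" "L \<subseteq> {1..M}" "\<And>j. j \<in> L \<Longrightarrow> r j \<noteq> {}"
  shows "rainbow_matching (card L) M C (r ` L)"
proof -
  have inj: "inj_on r L"
    using assms(1,3) unfolding is_rainbow_def disjoint_family_on_def
    by (intro inj_onI) (metis Int_absorb)
  have "disjoint (r ` L)"
    using assms(1) by (intro disjoint_family_on_disjoint_image) (simp add: is_rainbow_def)
  moreover have "inj_on (inv_into L r) (r ` L)"
    by (rule inj_on_inv_into) simp
  moreover have "inv_into L r A \<in> {1..M} \<and> A \<in> C (inv_into L r A)" if "A \<in> r ` L" for A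
    using that assms inj by (auto simp: is_rainbow_def)
  ultimately show ?thesis
    using assms(1) inj unfolding rainbow_matching_def is_rainbow_def
    by (auto simp: card_image)
qed

theorem theorem4:
  fixes n k s M :: nat and C :: "nat \<Rightarrow> nat set set"
  assumes "s \<ge> 3" and "k \<ge> 2" and "n \<ge> s * k + (s - 1) * (k - 1)"
    and "is_coloring n k M C"
    and "\<nexists>\<A>. rainbow_matching s M C \<A>"
  shows "star_like n s M C \<or> M \<le> h n k (s - 1) + s"
proof (rule disjCI)
  assume "\<not> M \<le> h n k (s - 1) + s"
  obtain m where s: "s = Suc (Suc m)" and "m \<ge> 1"
    using assms(1) by (intro that[of "s - 2"]) auto
  interpret uniform_colouring n k "{1..M}" C
    using assms(2,4) by unfold_locales (auto simp: is_coloring_def)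
  have "rainbow_free C {1..M} s"
    unfolding rainbow_free_def
  proof (intro allI impI notI)
    fix L r assume L: "L \<subseteq> {1..M} \<and> card L = s" and r: "is_rainbow C L r"
    have "r j \<noteq> {}" if "j \<in> L" for j
      using that L r by (intro class_memberD(5)[of "r j" j]) (auto simp: is_rainbow_def)
    then show False
      using rainbow_matching_image[OF r] L assms(5) by blast
  qed
  then show "star_like n s M C"
    using star_like_or_few_colours[of m] \<open>m \<ge> 1\<close> \<open>\<not> M \<le> h n k (s - 1) + s\<close> assms(3)
    by (simp add: star_like_def s)
qed

end
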